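(* Let $N_\mu=\{P\in S^3((k^2)^* ): P\ne 0\text{ and }\mu(P)\text{ is nonzero nilpotent}\}$. The group $\mathrm{Sl}(2,k)$ acts simply transitively on $N_\mu$. Consequently, $\mathrm{Gl}(2,k)$ has one orbit on $N_\mu$.
   Context: $k$ is a field of characteristic different from $2$ and $3$; $x,y$ is the standard coordinate basis of $(k^2)^*$; $S^3((k^2)^* )=\{ax^3+3bx^2y+3cxy^2+dy^3: a,b,c,d\in k\}$ is the space of binary cubics. $\mathrm{Gl}(2,k)$ and its subgroup $\mathrm{Sl}(2,k)$ act on $(k^2)^*$ by transpose inverse, $(g\cdot\phi)(v)=\phi(g^{-1}v)$, and functorially on $S^3((k^2)^* )$. The moment map $\mu:S^3((k^2)^* )\to\mathfrak{sl}(2,k)$ is $$\mu(ax^3+3bx^2y+3cxy^2+dy^3)=\begin{pmatrix} ad-bc & 2(bd-c^2)\\ 2(b^2-ac) & -(ad-bc)\end{pmatrix}.$$ *)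

theory Defs
  imports "HOL-Analysis.Analysis" "HOL-Algebra.Group_Action"
begin

text \<open>
  Binary cubics are rendered as cubic forms on \<open>k^2\<close>, i.e. as functions built from the coordinate
  functions \<open>x = (\<lambda>v. v $ 1)\<close> and \<open>y = (\<lambda>v. v $ 2)\<close>. In characteristic different from 2 and 3
  (so that \<open>k\<close> has at least five elements) a cubic form determines its coefficients, see
  \<open>cubic_eq_iff\<close> below, so nothing is lost by passing from \<open>S^3((k^2)^*)\<close> to functions.
\<close>

definition cubic :: "'k::field \<Rightarrow> 'k \<Rightarrow> 'k \<Rightarrow> 'k \<Rightarrow> 'k^2 \<Rightarrow> 'k" where
  "cubic a b c d = (\<lambda>v. a * (v $ 1)^3 + 3 * b * (v $ 1)^2 * v $ 2
                      + 3 * c * v $ 1 * (v $ 2)^2 + d * (v $ 2)^3)"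

definition binary_cubics :: "('k::field^2 \<Rightarrow> 'k) set" where
  "binary_cubics = {cubic a b c d | a b c d. True}"

lemma two_three_nonzero:
  assumes "CHAR('k::field) \<noteq> 2" and "CHAR('k) \<noteq> 3"
  shows "(2::'k) \<noteq> 0" and "(3::'k) \<noteq> 0"
proof -
  have "CHAR('k) \<noteq> 1" by simp
  moreover have "n = 1 \<or> n = 2" if "n dvd 2" for n :: nat
    using that by (metis prime_nat_iff two_is_prime_nat)
  moreover have "n = 1 \<or> n = 3" if "n dvd 3" for n :: nat
  proof -
    have "n \<le> 3" using that by (simp add: dvd_imp_le)
    then have "n = 0 \<or> n = 1 \<or> n = 2 \<or> n = 3" by linarith
    then show ?thesis using that by auto
  qed
  ultimately have "\<not> CHAR('k) dvd 2" "\<not> CHAR('k) dvd 3" using assms by blast+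
  then have "of_nat 2 \<noteq> (0::'k)" "of_nat 3 \<noteq> (0::'k)"
    by (simp_all only: of_nat_eq_0_iff_char_dvd not_False_eq_True)
  then show "(2::'k) \<noteq> 0" and "(3::'k) \<noteq> 0" by simp_all
qed

lemma cubic_eq_iff:
  fixes a b c d a' b' c' d' :: "'k::field"
  assumes "CHAR('k) \<noteq> 2" and "CHAR('k) \<noteq> 3"
  shows "cubic a b c d = cubic a' b' c' d' \<longleftrightarrow> a = a' \<and> b = b' \<and> c = c' \<and> d = d'"
proof
  assume eq: "cubic a b c d = cubic a' b' c' d'"
  have ev: "a * s^3 + 3 * b * s^2 * t + 3 * c * s * t^2 + d * t^3
          = a' * s^3 + 3 * b' * s^2 * t + 3 * c' * s * t^2 + d' * t^3" for s t :: 'k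
    using fun_cong[OF eq, of "vector [s, t]"] by (simp add: cubic_def)
  have a: "a = a'" using ev[of 1 0] by simp
  have d: "d = d'" using ev[of 0 1] by simp
  have p: "3 * b + 3 * c = 3 * b' + 3 * c'" using ev[of 1 1] a d by simp
  have m: "3 * c - 3 * b = 3 * c' - 3 * b'" using ev[of 1 "-1"] a d by simp
  have "2 * (3 * b) = (3 * b + 3 * c) - (3 * c - 3 * b)" by simp
  also have "\<dots> = 2 * (3 * b')" unfolding p m by simp
  finally have "3 * b = 3 * b'"
    using two_three_nonzero[OF assms] mult_left_cancel[of 2 "3 * b" "3 * b'"] by blast
  then have b: "b = b'" using two_three_nonzero[OF assms] by simp
  show "a = a' \<and> b = b' \<and> c = c' \<and> d = d'"
    using a b d p two_three_nonzero[OF assms] by simp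
qed simp

definition cubic_moment :: "('k::field^2 \<Rightarrow> 'k) \<Rightarrow> 'k^2^2" where
  "cubic_moment P = (THE M. \<exists>a b c d. P = cubic a b c d \<and>
     M = vector [vector [a * d - b * c, 2 * (b * d - c^2)],
                 vector [2 * (b^2 - a * c), - (a * d - b * c)]])"

lemma cubic_moment_cubic:
  fixes a b c d :: "'k::field"
  assumes "CHAR('k) \<noteq> 2" and "CHAR('k) \<noteq> 3"
  shows "cubic_moment (cubic a b c d) =
     vector [vector [a * d - b * c, 2 * (b * d - c^2)],
             vector [2 * (b^2 - a * c), - (a * d - b * c)]]"
  unfolding cubic_moment_def by (rule the_equality) (auto simp: cubic_eq_iff[OF assms])

text \<open>
  Powers of a matrix are iterated matrix products here: \<open>A ^ n\<close> would be the componentwise power.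
\<close>

definition nilpotent_matrix :: "'k::field^'n^'n \<Rightarrow> bool" where
  "nilpotent_matrix A \<longleftrightarrow> (\<exists>n. (((**) A) ^^ n) (mat 1) = 0)"

definition N_mu :: "('k::field^2 \<Rightarrow> 'k) set" where
  "N_mu = {P \<in> binary_cubics. P \<noteq> (\<lambda>v. 0) \<and>
             cubic_moment P \<noteq> 0 \<and> nilpotent_matrix (cubic_moment P)}"

definition GL2 :: "('k::field^2^2) monoid" where
  "GL2 = \<lparr>carrier = {g. invertible g}, mult = (**), one = mat 1\<rparr>"

definition SL2 :: "('k::field^2^2) monoid" where
  "SL2 = \<lparr>carrier = {g. det g = 1}, mult = (**), one = mat 1\<rparr>"

text \<open>
  On linear forms this is the transpose inverse action; it is multiplicative in \<open>P\<close>, hence is the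
  induced action on cubic forms. The restriction to \<open>E\<close> is what \<^locale>\<open>group_action\<close> requires.
\<close>

definition form_action :: "('k::field^2 \<Rightarrow> 'k) set \<Rightarrow> 'k^2^2 \<Rightarrow> ('k^2 \<Rightarrow> 'k) \<Rightarrow> 'k^2 \<Rightarrow> 'k" where
  "form_action E g = (\<lambda>P\<in>E. \<lambda>v. P (matrix_inv g *v v))"

definition simply_transitive :: "('g, 'm) monoid_scheme \<Rightarrow> 'a set \<Rightarrow> ('g \<Rightarrow> 'a \<Rightarrow> 'a) \<Rightarrow> bool" where
  "simply_transitive G E \<phi> \<longleftrightarrow> group_action G E \<phi> \<and> E \<noteq> {} \<and>
     (\<forall>p\<in>E. \<forall>q\<in>E. \<exists>!g. g \<in> carrier G \<and> \<phi> g p = q)"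

end

theory Submission
  imports Defs
begin

text \<open>
  A cubic has nonzero nilpotent moment exactly when it is \<open>3 l^2 m\<close> with independent linear forms
  \<open>l\<close>, \<open>m\<close>. Indeed the entries of the moment are, up to constant factors, the coefficients
  of the Hessian \<open>A x^2 + B x y + C y^2\<close>, and nilpotency says that the Hessian is a square up to a scalar; its double
  root lies in \<open>k\<close> and is a double root of the cubic. Replacing \<open>(l, m)\<close> by \<open>(s l, s^(-2) m)\<close>
  leaves the cubic unchanged and divides the determinant of the pair by \<open>s\<close>, so there is exactly one
  such pair of determinant 1. In other words, every element of \<^const>\<open>N_mu\<close> is the pullback of
  \<open>3 x^2 y\<close> along exactly one matrix of determinant 1, whose rows are \<open>l\<close> and \<open>m\<close>.

  The description as pullbacks along invertible matrices also makes it evident that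
  \<open>Gl(2,k)\<close> preserves \<^const>\<open>N_mu\<close>. The two descriptions are \<open>pullback_base_cubic_in_N_mu\<close> and
  \<open>N_mu_unimodular_pullback\<close>, and the uniqueness is \<open>base_cubic_stabilizer\<close>.
\<close>

section \<open>Group actions\<close>

text \<open>Bijectivity comes for free: the inverse of \<open>\<phi> g\<close> is \<open>\<phi>\<close> of the inverse of \<open>g\<close>.\<close>

lemma group_actionI:
  assumes "group G"
    and ext: "\<And>g. g \<in> carrier G \<Longrightarrow> \<phi> g \<in> extensional E"
    and closed: "\<And>g p. g \<in> carrier G \<Longrightarrow> p \<in> E \<Longrightarrow> \<phi> g p \<in> E"
    and one: "\<And>p. p \<in> E \<Longrightarrow> \<phi> \<one>\<^bsub>G\<^esub> p = p"
    and mult: "\<And>g h p. g \<in> carrier G \<Longrightarrow> h \<in> carrier G \<Longrightarrow> p \<in> E \<Longrightarrow>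
                 \<phi> (g \<otimes>\<^bsub>G\<^esub> h) p = \<phi> g (\<phi> h p)"
  shows "group_action G E \<phi>"
proof -
  interpret group G by fact
  have bij: "\<phi> g \<in> Bij E" if g: "g \<in> carrier G" for g
  proof -
    have "bij_betw (\<phi> g) E E"
    proof (rule bij_betw_byWitness[where f' = "\<phi> (inv\<^bsub>G\<^esub> g)"])
      show "\<forall>p\<in>E. \<phi> (inv\<^bsub>G\<^esub> g) (\<phi> g p) = p"
        using g mult[of "inv\<^bsub>G\<^esub> g" g] one by auto
      show "\<forall>p\<in>E. \<phi> g (\<phi> (inv\<^bsub>G\<^esub> g) p) = p"
        using g mult[of g "inv\<^bsub>G\<^esub> g"] one by auto
    qed (use g closed in auto)
    then show ?thesis using ext[OF g] by (simp add: Bij_def)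
  qed
  have "\<phi> (g \<otimes>\<^bsub>G\<^esub> h) = compose E (\<phi> g) (\<phi> h)"
    if "g \<in> carrier G" "h \<in> carrier G" for g h
  proof (rule extensionalityI[of _ E])
    show "\<phi> (g \<otimes>\<^bsub>G\<^esub> h) \<in> extensional E" using that ext by simp
    show "compose E (\<phi> g) (\<phi> h) \<in> extensional E" by simp
    show "\<phi> (g \<otimes>\<^bsub>G\<^esub> h) p = compose E (\<phi> g) (\<phi> h) p" if "p \<in> E" for p
      using that mult[OF \<open>g \<in> carrier G\<close> \<open>h \<in> carrier G\<close>] by (simp add: compose_def)
  qed
  then have "\<phi> \<in> hom G (BijGroup E)"
    using bij by (auto simp: hom_def BijGroup_def)
  then show ?thesis
    unfolding group_action_def group_hom_def group_hom_axioms_def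
    using \<open>group G\<close> group_BijGroup by blast
qed

text \<open>Simple transitivity can be tested at one point, since stabilizers in an orbit are conjugate.\<close>

lemma simply_transitiveI:
  assumes "group_action G E \<phi>" and e: "e \<in> E"
    and trans: "\<And>q. q \<in> E \<Longrightarrow> \<exists>g\<in>carrier G. \<phi> g e = q"
    and free: "\<And>g. g \<in> carrier G \<Longrightarrow> \<phi> g e = e \<Longrightarrow> g = \<one>\<^bsub>G\<^esub>"
  shows "simply_transitive G E \<phi>"
  unfolding simply_transitive_def
proof (intro conjI ballI)
  interpret group_action G E \<phi> by fact
  interpret group G using group_hom group_hom.axioms(1) by blast
  fix p q assume p: "p \<in> E" and q: "q \<in> E"
  obtain a where a: "a \<in> carrier G" "\<phi> a e = p" using trans[OF p] by blast
  obtain b where b: "b \<in> carrier G" "\<phi> b e = q" using trans[OF q] by blast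
  have inverses: "\<phi> (inv\<^bsub>G\<^esub> b) q = e" "\<phi> (inv\<^bsub>G\<^esub> a) p = e"
    using orbit_sym_aux a b e by auto
  show "\<exists>!g. g \<in> carrier G \<and> \<phi> g p = q"
  proof (rule ex1I[of _ "b \<otimes>\<^bsub>G\<^esub> inv\<^bsub>G\<^esub> a"])
    show "b \<otimes>\<^bsub>G\<^esub> inv\<^bsub>G\<^esub> a \<in> carrier G \<and> \<phi> (b \<otimes>\<^bsub>G\<^esub> inv\<^bsub>G\<^esub> a) p = q"
      using a b p inverses composition_rule by simp
  next
    fix g assume g: "g \<in> carrier G \<and> \<phi> g p = q"
    then have "\<phi> (inv\<^bsub>G\<^esub> b \<otimes>\<^bsub>G\<^esub> (g \<otimes>\<^bsub>G\<^esub> a)) e = e"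
      using a b e inverses composition_rule by simp
    then have "inv\<^bsub>G\<^esub> b \<otimes>\<^bsub>G\<^esub> (g \<otimes>\<^bsub>G\<^esub> a) = \<one>\<^bsub>G\<^esub>"
      using free g a b by simp
    then have "g \<otimes>\<^bsub>G\<^esub> a = b"
      using g a b inv_solve_left'[of "\<one>\<^bsub>G\<^esub>" b "g \<otimes>\<^bsub>G\<^esub> a"] by simp
    then show "g = b \<otimes>\<^bsub>G\<^esub> inv\<^bsub>G\<^esub> a"
      using g a b inv_solve_right by blast
  qed
qed (use assms in auto)

section \<open>Matrix groups acting on functions\<close>

lemma matrix_inv_inverse:
  fixes g :: "'k::field^'n^'n"
  assumes "invertible g"
  shows "g ** matrix_inv g = mat 1" "matrix_inv g ** g = mat 1"
  using assms someI_ex[of "\<lambda>h. g ** h = mat 1 \<and> h ** g = mat 1"]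
  by (auto simp: invertible_def matrix_inv_def)

lemma matrix_inv_unique:
  fixes g h :: "'k::field^'n^'n"
  assumes "g ** h = mat 1"
  shows "matrix_inv g = h"
proof -
  have "invertible g" using assms invertible_right_inverse by blast
  have "matrix_inv g = matrix_inv g ** (g ** h)" by (simp add: assms)
  also have "\<dots> = h"
    using matrix_inv_inverse[OF \<open>invertible g\<close>] by (simp add: matrix_mul_assoc)
  finally show ?thesis .
qed

lemma invertible_matrix_inv:
  fixes g :: "'k::field^'n^'n"
  assumes "invertible g"
  shows "invertible (matrix_inv g)"
  using matrix_inv_inverse[OF assms] invertible_def by blast

lemma matrix_inv_matrix_inv:
  fixes g :: "'k::field^'n^'n"
  assumes "invertible g"
  shows "matrix_inv (matrix_inv g) = g"
  using matrix_inv_inverse[OF assms] matrix_inv_unique by blast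

lemma matrix_inv_mult:
  fixes g h :: "'k::field^'n^'n"
  assumes "invertible g" "invertible h"
  shows "matrix_inv (g ** h) = matrix_inv h ** matrix_inv g"
proof (rule matrix_inv_unique)
  have "g ** h ** (matrix_inv h ** matrix_inv g) = g ** (h ** matrix_inv h) ** matrix_inv g"
    by (simp add: matrix_mul_assoc)
  then show "g ** h ** (matrix_inv h ** matrix_inv g) = mat 1"
    using assms by (simp add: matrix_inv_inverse)
qed

lemma det_matrix_inv:
  fixes g :: "'k::field^'n^'n"
  assumes "det g = 1"
  shows "det (matrix_inv g) = 1"
proof -
  have "invertible g" using assms by (simp add: invertible_det_nz)
  then have "det (g ** matrix_inv g) = 1" by (simp add: matrix_inv_inverse)
  then show ?thesis using assms by (simp add: det_mul)
qed

lemma group_GL2: "group (GL2 :: ('k::field^2^2) monoid)"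
proof (rule groupI)
  fix g :: "'k^2^2" assume "g \<in> carrier GL2"
  then show "\<exists>h\<in>carrier GL2. h \<otimes>\<^bsub>GL2\<^esub> g = \<one>\<^bsub>GL2\<^esub>"
    using invertible_matrix_inv matrix_inv_inverse by (fastforce simp: GL2_def)
qed (auto simp: GL2_def matrix_mul_assoc det_mul invertible_det_nz)

lemma group_SL2: "group (SL2 :: ('k::field^2^2) monoid)"
proof (rule groupI)
  fix g :: "'k^2^2" assume "g \<in> carrier SL2"
  then have "det g = 1" by (simp add: SL2_def)
  moreover from this have "invertible g" by (simp add: invertible_det_nz)
  ultimately show "\<exists>h\<in>carrier SL2. h \<otimes>\<^bsub>SL2\<^esub> g = \<one>\<^bsub>SL2\<^esub>"
    using det_matrix_inv matrix_inv_inverse by (fastforce simp: SL2_def)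
qed (auto simp: SL2_def matrix_mul_assoc det_mul)

lemma form_action_comp:
  "P \<in> E \<Longrightarrow> form_action E g P = P \<circ> (*v) (matrix_inv g)"
  by (simp add: form_action_def comp_def)

lemma comp_matrix_mult:
  fixes P :: "'k::field^'n \<Rightarrow> 'b" and g h :: "'k^'n^'n"
  shows "P \<circ> (*v) (g ** h) = P \<circ> (*v) g \<circ> (*v) h"
  by (simp add: fun_eq_iff matrix_vector_mul_assoc)

lemma group_action_form_action:
  fixes G :: "('k::field^2^2) monoid"
  assumes "group G" and inv: "carrier G \<subseteq> {g. invertible g}"
    and ops: "mult G = (**)" "one G = mat 1"
    and closed: "\<And>P h. P \<in> E \<Longrightarrow> invertible h \<Longrightarrow> P \<circ> (*v) h \<in> E"
  shows "group_action G E (form_action E)"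
proof (rule group_actionI)
  show "group G" by fact
  show "form_action E g \<in> extensional E" for g by (simp add: form_action_def)
next
  fix g P assume "g \<in> carrier G" "P \<in> E"
  then show "form_action E g P \<in> E"
    using closed invertible_matrix_inv inv by (auto simp: form_action_comp)
next
  fix P assume "P \<in> E"
  moreover have "matrix_inv (mat 1 :: 'k^2^2) = mat 1" by (rule matrix_inv_unique) simp
  ultimately show "form_action E \<one>\<^bsub>G\<^esub> P = P"
    by (simp add: form_action_comp ops fun_eq_iff)
next
  fix g h P assume "g \<in> carrier G" "h \<in> carrier G" "P \<in> E"
  moreover from this have "invertible g" "invertible h" using inv by auto
  ultimately show "form_action E (g \<otimes>\<^bsub>G\<^esub> h) P = form_action E g (form_action E h P)"
    by (simp add: form_action_comp ops matrix_inv_mult comp_matrix_mult closed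
        invertible_matrix_inv)
qed

section \<open>Nilpotent matrices of size two\<close>

lemma nilpotent_matrix_imp_det_0:
  fixes A :: "'k::field^'n^'n"
  assumes "nilpotent_matrix A"
  shows "det A = 0"
proof -
  obtain n where n: "(((**) A) ^^ n) (mat 1) = 0" using assms nilpotent_matrix_def by blast
  have "det ((((**) A) ^^ m) (mat 1)) = det A ^ m" for m
    by (induction m) (simp_all add: det_mul)
  moreover have "det (0 :: 'k^'n^'n) = 0" using det_0 by (simp add: mat_def zero_vec_def)
  ultimately have "det A ^ n = 0" using n by metis
  then show ?thesis by simp
qed

lemma matrix_mult_2:
  fixes A B :: "'k::field^2^2"
  shows "(A ** B) $ i $ j = A $ i $ 1 * B $ 1 $ j + A $ i $ 2 * B $ 2 $ j"
  by (simp add: matrix_matrix_mult_def sum_2)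

text \<open>A traceless matrix of determinant 0 has square 0.\<close>

lemma nilpotent_matrix_traceless:
  fixes u v w :: "'k::field"
  shows "nilpotent_matrix (vector [vector [u, v], vector [w, - u]] :: 'k^2^2) \<longleftrightarrow> u^2 + v * w = 0"
    (is "nilpotent_matrix ?A \<longleftrightarrow> _")
proof
  assume "nilpotent_matrix ?A"
  then have "det ?A = 0" by (rule nilpotent_matrix_imp_det_0)
  then have "- (u * u) = v * w" by (simp add: det_2)
  then show "u^2 + v * w = 0" by algebra
next
  assume "u^2 + v * w = 0"
  then have "v * w = - (u * u)" by algebra
  then have "?A ** ?A = 0"
    by (simp add: vec_eq_iff forall_2 matrix_mult_2 power2_eq_square mult.commute add.commute)
  then have "(((**) ?A) ^^ 2) (mat 1) = 0" by (simp add: numeral_2_eq_2)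
  then show "nilpotent_matrix ?A" unfolding nilpotent_matrix_def by blast
qed

section \<open>Cubics with nonzero nilpotent moment\<close>

text \<open>The condition says that the Hessian, whose coefficients are the three quantities below, is
  nonzero and has discriminant 0.\<close>

lemma cubic_in_N_mu_iff:
  fixes a b c d :: "'k::field"
  assumes "CHAR('k) \<noteq> 2" and "CHAR('k) \<noteq> 3"
  shows "cubic a b c d \<in> N_mu \<longleftrightarrow>
    (b^2 - a * c \<noteq> 0 \<or> b * c - a * d \<noteq> 0 \<or> c^2 - b * d \<noteq> 0) \<and>
    (b * c - a * d)^2 = 4 * (b^2 - a * c) * (c^2 - b * d)"
proof -
  note two = two_three_nonzero(1)[OF assms]
  let ?M = "cubic_moment (cubic a b c d)"
  note M = cubic_moment_cubic[OF assms]
  have nil: "nilpotent_matrix ?M \<longleftrightarrow> (b * c - a * d)^2 = 4 * (b^2 - a * c) * (c^2 - b * d)"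
    unfolding M nilpotent_matrix_traceless by (auto simp: algebra_simps power2_eq_square)
  have nz: "?M \<noteq> 0 \<longleftrightarrow> b^2 - a * c \<noteq> 0 \<or> b * c - a * d \<noteq> 0 \<or> c^2 - b * d \<noteq> 0"
    unfolding M using two by (auto simp: vec_eq_iff forall_2)
  \<comment> \<open>The zero cubic has moment 0.\<close>
  have "cubic a b c d \<noteq> (\<lambda>v. 0)" if "?M \<noteq> 0"
  proof
    assume "cubic a b c d = (\<lambda>v. 0)"
    then have "cubic a b c d = cubic 0 0 0 0" by (simp add: cubic_def fun_eq_iff)
    then have "a = 0" "b = 0" "c = 0" "d = 0" using cubic_eq_iff[OF assms] by auto
    then show False using that nz by simp
  qed
  then show ?thesis unfolding nil[symmetric] nz[symmetric]
    by (auto simp: N_mu_def binary_cubics_def)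
qed

text \<open>The cubic \<open>3 x^2 y\<close>; the factor 3 keeps the coefficients of its pullbacks free of fractions.\<close>

definition base_cubic :: "'k::field^2 \<Rightarrow> 'k" where
  "base_cubic = cubic 0 1 0 0"

lemma pullback_base_cubic:
  fixes h :: "'k::field^2^2"
  shows "base_cubic \<circ> (*v) h =
    cubic (3 * (h$1$1)^2 * h$2$1) ((h$1$1)^2 * h$2$2 + 2 * h$1$1 * h$1$2 * h$2$1)
          ((h$1$2)^2 * h$2$1 + 2 * h$1$1 * h$1$2 * h$2$2) (3 * (h$1$2)^2 * h$2$2)"
  by (simp add: base_cubic_def cubic_def fun_eq_iff matrix_vector_mult_def sum_2
      algebra_simps power2_eq_square power3_eq_cube)

text \<open>The Hessian of \<open>3 l^2 m\<close> is \<open>l^2\<close> times the square of the determinant of \<open>(l, m)\<close>.\<close>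

lemma pullback_base_cubic_in_N_mu:
  fixes h :: "'k::field^2^2"
  assumes "CHAR('k) \<noteq> 2" and "CHAR('k) \<noteq> 3" and "invertible h"
  shows "base_cubic \<circ> (*v) h \<in> N_mu"
proof -
  define p q r s where "p = h$1$1" "q = h$1$2" "r = h$2$1" "s = h$2$2"
  note pqrs = this
  define D where "D = p * s - q * r"
  have D: "D \<noteq> 0" using assms(3) by (simp add: invertible_det_nz det_2 D_def pqrs)
  define a b c d where "a = 3 * p^2 * r" "b = p^2 * s + 2 * p * q * r"
    "c = q^2 * r + 2 * p * q * s" "d = 3 * q^2 * s"
  note abcd = this
  have A: "b^2 - a * c = (p * D)^2" unfolding abcd D_def by algebra
  have B: "b * c - a * d = 2 * p * q * D^2" unfolding abcd D_def by algebra
  have C: "c^2 - b * d = (q * D)^2" unfolding abcd D_def by algebra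
  have "p \<noteq> 0 \<or> q \<noteq> 0" using D D_def by auto
  then have "cubic a b c d \<in> N_mu"
    unfolding cubic_in_N_mu_iff[OF assms(1,2)] A B C using D
    by (auto simp: power2_eq_square)
  then show ?thesis by (simp add: pullback_base_cubic abcd pqrs)
qed

text \<open>
  The double root of the Hessian is the double root of the cubic, which gives the linear form \<open>l\<close>
  up to a scalar; the scalar is then forced by the determinant.
\<close>

lemma N_mu_unimodular_pullback:
  fixes P :: "'k::field^2 \<Rightarrow> 'k"
  assumes "CHAR('k) \<noteq> 2" and "CHAR('k) \<noteq> 3" and "P \<in> N_mu"
  obtains h :: "'k^2^2" where "det h = 1" and "P = base_cubic \<circ> (*v) h"
proof -
  note two = two_three_nonzero(1)[OF assms(1,2)] and three = two_three_nonzero(2)[OF assms(1,2)]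
  obtain a b c d where P: "P = cubic a b c d"
    using assms(3) by (auto simp: N_mu_def binary_cubics_def)
  define A B C where "A = b^2 - a * c" "B = b * c - a * d" "C = c^2 - b * d"
  note ABC = this
  have nz: "A \<noteq> 0 \<or> B \<noteq> 0 \<or> C \<noteq> 0" and disc: "B^2 = 4 * A * C"
    using assms(3) unfolding P cubic_in_N_mu_iff[OF assms(1,2)] ABC by blast+
  have "\<exists>p q r s. p * s - q * r = 1 \<and> a = 3 * p^2 * r \<and> b = p^2 * s + 2 * p * q * r \<and>
          c = q^2 * r + 2 * p * q * s \<and> d = 3 * q^2 * s"
  proof (cases "A = 0")
    case False
    \<comment> \<open>Here the Hessian is \<open>A (x + t y)^2\<close>, so \<open>l\<close> is a multiple of \<open>x + t y\<close>.\<close>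
    define t where "t = B / (2 * A)"
    have B: "B = 2 * A * t" using False two by (simp add: t_def)
    have "4 * A * C = 4 * A * (A * t^2)" using disc unfolding B by algebra
    moreover have "4 * A \<noteq> 0" using False two mult_eq_0_iff[of 2 "2::'k"] by simp
    ultimately have C: "C = A * t^2" by simp
    \<comment> \<open>Both partial derivatives of the cubic vanish at \<open>(-t, 1)\<close>.\<close>
    have "A * (a * t^2 - 2 * b * t + c) = a * C - b * B + c * A" unfolding B C by algebra
    also have "\<dots> = 0" unfolding ABC by algebra
    finally have "a * t^2 - 2 * b * t + c = 0" using False by simp
    then have c: "c = 2 * b * t - a * t^2" by algebra
    have "A * (b * t^2 - 2 * c * t + d) = b * C - c * B + d * A" unfolding B C by algebra
    also have "\<dots> = 0" unfolding ABC by algebra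
    finally have "b * t^2 - 2 * c * t + d = 0" using False by simp
    then have d: "d = 2 * c * t - b * t^2" by algebra
    define p where "p = b - t * a"
    have "p^2 = A" unfolding ABC c p_def by algebra
    then have p: "p \<noteq> 0" using False by auto
    \<comment> \<open>The cubic is \<open>(x + t y)^2 (a x + (3 b - 2 t a) y)\<close>, and \<open>p\<close> is the scalar that makes the
      determinant 1.\<close>
    define r s where "r = a / (3 * p^2)" "s = (3 * b - 2 * t * a) / (3 * p^2)"
    have r: "3 * p^2 * r = a" and s: "3 * p^2 * s = 3 * b - 2 * t * a"
      using p three by (simp_all add: r_s_def)
    have "3 * p * (p * s - t * p * r) = 3 * p^2 * s - t * (3 * p^2 * r)" by algebra
    also have "\<dots> = 3 * p * 1" unfolding r s by (simp add: p_def algebra_simps)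
    finally have "p * s - t * p * r = 1" using p three mult_left_cancel[of "3 * p"] by simp
    moreover have "b = p^2 * s + 2 * p * (t * p) * r"
    proof -
      have "3 * (p^2 * s + 2 * p * (t * p) * r) = 3 * p^2 * s + 2 * t * (3 * p^2 * r)" by algebra
      also have "\<dots> = 3 * b" unfolding r s by (simp add: algebra_simps)
      finally show ?thesis using three by (metis mult_left_cancel)
    qed
    moreover have "c = (t * p)^2 * r + 2 * p * (t * p) * s"
    proof -
      have "3 * ((t * p)^2 * r + 2 * p * (t * p) * s)
          = t^2 * (3 * p^2 * r) + 2 * t * (3 * p^2 * s)" by algebra
      also have "\<dots> = 3 * c" unfolding r s c by algebra
      finally show ?thesis using three by (metis mult_left_cancel)
    qed
    moreover have "d = 3 * (t * p)^2 * s"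
    proof -
      have "3 * (t * p)^2 * s = t^2 * (3 * p^2 * s)" by algebra
      also have "\<dots> = d" unfolding s d c by algebra
      finally show ?thesis by simp
    qed
    ultimately show ?thesis using r[symmetric] by metis
  next
    case True
    \<comment> \<open>Now the Hessian is \<open>C y^2\<close>, so \<open>l\<close> is a multiple of \<open>y\<close>.\<close>
    then have B: "B = 0" using disc by simp
    then have C: "C \<noteq> 0" using nz True by simp
    have "a * a * C = 0" using True B unfolding ABC by algebra
    then have a: "a = 0" using C by simp
    then have b: "b = 0" using True ABC by simp
    have c: "c \<noteq> 0" using C ABC a b by simp
    show ?thesis
      by (rule exI[of _ 0], rule exI[of _ "- c"], rule exI[of _ "1 / c"],
          rule exI[of _ "d / (3 * c^2)"]) (use a b c three in \<open>simp add: power2_eq_square\<close>)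
  qed
  then obtain p q r s where h: "p * s - q * r = 1" "a = 3 * p^2 * r" "b = p^2 * s + 2 * p * q * r"
      "c = q^2 * r + 2 * p * q * s" "d = 3 * q^2 * s" by blast
  show ?thesis
  proof (rule that[of "vector [vector [p, q], vector [r, s]]"])
    show "det (vector [vector [p, q], vector [r, s]] :: 'k^2^2) = 1" using h(1) by (simp add: det_2)
    show "P = base_cubic \<circ> (*v) (vector [vector [p, q], vector [r, s]])"
      unfolding pullback_base_cubic P by (simp add: h(2-5))
  qed
qed

text \<open>
  By unique factorization a stabilizing matrix scales \<open>x\<close> and \<open>y\<close>, by factors \<open>p\<close> and \<open>s\<close> with
  \<open>p^2 s = 1\<close>; then \<open>p s = 1\<close> leaves only the identity.
\<close>

lemma base_cubic_stabilizer:
  fixes h :: "'k::field^2^2"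
  assumes "CHAR('k) \<noteq> 2" and "CHAR('k) \<noteq> 3"
    and det: "det h = 1" and fixed: "base_cubic \<circ> (*v) h = base_cubic"
  shows "h = mat 1"
proof -
  note two = two_three_nonzero(1)[OF assms(1,2)] and three = two_three_nonzero(2)[OF assms(1,2)]
  define p q r s where "p = h$1$1" "q = h$1$2" "r = h$2$1" "s = h$2$2"
  note pqrs = this
  have D: "p * s - q * r = 1" using det by (simp add: det_2 pqrs)
  have "cubic (3 * p^2 * r) (p^2 * s + 2 * p * q * r) (q^2 * r + 2 * p * q * s) (3 * q^2 * s)
      = cubic 0 1 0 0"
    using fixed unfolding pullback_base_cubic by (simp add: base_cubic_def pqrs)
  then have E: "3 * p^2 * r = 0" "p^2 * s + 2 * p * q * r = 1"
      "q^2 * r + 2 * p * q * s = 0"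
    unfolding cubic_eq_iff[OF assms(1,2)] by blast+
  have p: "p \<noteq> 0" using E(2) by auto
  then have r: "r = 0" using E(1) three by simp
  then have ps: "p * s = 1" using D by simp
  then have "p = 1" using E(2) r by (simp add: power2_eq_square mult.assoc)
  moreover from this have "s = 1" using ps by simp
  moreover have "q = 0" using E(3) r p two \<open>s = 1\<close> by simp
  ultimately show ?thesis using r by (simp add: vec_eq_iff forall_2 mat_def pqrs)
qed

theorem proposition3p13:
  assumes "CHAR('k::field) \<noteq> 2" and "CHAR('k) \<noteq> 3"
  shows "simply_transitive (SL2 :: ('k^2^2) monoid) N_mu (form_action N_mu)
       \<and> group_action (GL2 :: ('k^2^2) monoid) N_mu (form_action N_mu)
       \<and> orbits (GL2 :: ('k^2^2) monoid) N_mu (form_action N_mu) = {N_mu}"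
proof -
  let ?\<phi> = "form_action N_mu :: 'k^2^2 \<Rightarrow> ('k^2 \<Rightarrow> 'k) \<Rightarrow> 'k^2 \<Rightarrow> 'k"
  have SL_inv: "invertible g" if "det g = 1" for g :: "'k^2^2"
    using that by (simp add: invertible_det_nz)
  have closed: "P \<circ> (*v) h \<in> N_mu" if P: "P \<in> N_mu" and h: "invertible h"
    for P :: "'k^2 \<Rightarrow> 'k" and h :: "'k^2^2"
  proof -
    obtain g :: "'k^2^2" where "det g = 1" "P = base_cubic \<circ> (*v) g"
      using N_mu_unimodular_pullback[OF assms P] by blast
    then show ?thesis
      using pullback_base_cubic_in_N_mu[OF assms, of "g ** h"] SL_inv h
      by (simp add: comp_matrix_mult invertible_mult)
  qed
  have GL: "group_action (GL2 :: ('k^2^2) monoid) N_mu ?\<phi>"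
    by (rule group_action_form_action[OF group_GL2 _ _ _ closed]) (auto simp: GL2_def)
  have SL: "group_action (SL2 :: ('k^2^2) monoid) N_mu ?\<phi>"
    by (rule group_action_form_action[OF group_SL2 _ _ _ closed]) (auto simp: SL2_def SL_inv)
  have base: "(base_cubic :: 'k^2 \<Rightarrow> 'k) \<in> N_mu"
    using pullback_base_cubic_in_N_mu[OF assms, of "mat 1"]
    by (simp add: comp_def invertible_det_nz)
  have st: "simply_transitive (SL2 :: ('k^2^2) monoid) N_mu ?\<phi>"
  proof (rule simply_transitiveI[OF SL base])
    fix Q :: "'k^2 \<Rightarrow> 'k" assume "Q \<in> N_mu"
    then obtain h :: "'k^2^2" where h: "det h = 1" "Q = base_cubic \<circ> (*v) h"
      using N_mu_unimodular_pullback[OF assms] by blast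
    then have "?\<phi> (matrix_inv h) base_cubic = Q"
      using base SL_inv by (simp add: form_action_comp matrix_inv_matrix_inv)
    then show "\<exists>g\<in>carrier SL2. ?\<phi> g base_cubic = Q"
      using det_matrix_inv[OF h(1)] by (auto simp: SL2_def)
  next
    fix g :: "'k^2^2" assume g: "g \<in> carrier SL2" and "?\<phi> g base_cubic = base_cubic"
    then have "matrix_inv g = mat 1"
      using base by (intro base_cubic_stabilizer[OF assms])
        (simp_all add: form_action_comp SL2_def det_matrix_inv)
    then show "g = \<one>\<^bsub>SL2\<^esub>"
      using matrix_inv_inverse[of g] g SL_inv by (simp add: SL2_def)
  qed
  have "orbit (GL2 :: ('k^2^2) monoid) ?\<phi> P = N_mu" if P: "P \<in> N_mu" for P
  proof
    show "orbit (GL2 :: ('k^2^2) monoid) ?\<phi> P \<subseteq> N_mu"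
      using group_action.element_image[OF GL] P by (auto simp: orbit_def)
    show "N_mu \<subseteq> orbit (GL2 :: ('k^2^2) monoid) ?\<phi> P"
    proof
      fix Q :: "'k^2 \<Rightarrow> 'k" assume "Q \<in> N_mu"
      then obtain g where "g \<in> carrier SL2" "?\<phi> g P = Q"
        using st P unfolding simply_transitive_def by blast
      then show "Q \<in> orbit (GL2 :: ('k^2^2) monoid) ?\<phi> P"
        using SL_inv by (auto simp: orbit_def GL2_def SL2_def)
    qed
  qed
  then have "orbits (GL2 :: ('k^2^2) monoid) N_mu ?\<phi> = {N_mu}"
    using base unfolding orbits_def by blast
  then show ?thesis using st GL by blast
qed

end
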